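(* Let $\lambda\ge2$ be an integer and let $\mathbf{vtm}_\lambda$ be the fixed point starting with $0$ of the morphism $f_\lambda:0\mapsto01\lambda$, $1\mapsto0\lambda$, $\lambda\mapsto1$ over the alphabet $\{0,1,\lambda\}$. If $\lambda\ge5$, then $\rho^{\mathrm{add}}_{\mathbf{vtm}_\lambda}(n)=\rho^{\mathrm{ab}}_{\mathbf{vtm}_\lambda}(n)$ for all $n\ge0$.
   Context: Letters $0,1,\lambda$ are regarded as integers. For a word $w$, $|w|_a$ counts occurrences of $a$. Words $u,v$ are abelian equivalent if $|u|_a=|v|_a$ for all letters $a$, and additively equivalent if $|u|=|v|$ and $|u|_1+\lambda|u|_\lambda=|v|_1+\lambda|v|_\lambda$. $\rho^{\mathrm{ab}}_{\mathbf{x}}(n)$ (resp. $\rho^{\mathrm{add}}_{\mathbf{x}}(n)$) is the number of abelian (resp. additive) equivalence classes of length-$n$ factors of $\mathbf{x}$. *)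

theory Defs
  imports "HOL-Library.Stream"
begin

text \<open>Letters are integers, finite words are lists, infinite words are streams.\<close>

definition factors :: "'a stream \<Rightarrow> nat \<Rightarrow> 'a list set" where
  "factors x n = {stake n (sdrop i x) | i. True}"

definition abelian_equiv :: "'a list \<Rightarrow> 'a list \<Rightarrow> bool" where
  "abelian_equiv u v \<longleftrightarrow> (\<forall>a. count_list u a = count_list v a)"

definition additive_equiv :: "int \<Rightarrow> int list \<Rightarrow> int list \<Rightarrow> bool" where
  "additive_equiv l u v \<longleftrightarrow> length u = length v \<and>
     int (count_list u 1) + l * int (count_list u l) =
     int (count_list v 1) + l * int (count_list v l)"

definition abelian_complexity :: "'a stream \<Rightarrow> nat \<Rightarrow> nat" where
  "abelian_complexity x n =
     card (factors x n // {(u, v) \<in> factors x n \<times> factors x n. abelian_equiv u v})"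

definition additive_complexity :: "int \<Rightarrow> int stream \<Rightarrow> nat \<Rightarrow> nat" where
  "additive_complexity l x n =
     card (factors x n // {(u, v) \<in> factors x n \<times> factors x n. additive_equiv l u v})"

text \<open>
  The constant \<^const>\<open>flat\<close> has its intended meaning only on streams of nonempty
  lists, so this is the action of a morphism on infinite words for nonerasing morphisms only.
\<close>

definition morph_stream :: "('a \<Rightarrow> 'b list) \<Rightarrow> 'a stream \<Rightarrow> 'b stream" where
  "morph_stream f x = flat (smap f x)"

text \<open>The final branch is the image of the letter \<open>l\<close>; its value off the alphabet is irrelevant.\<close>

definition vtm_morph :: "int \<Rightarrow> int \<Rightarrow> int list" where
  "vtm_morph l a = (if a = 0 then [0, 1, l] else if a = 1 then [0, l] else [1])"

definition vtm :: "int \<Rightarrow> int stream" where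
  "vtm l = (THE x. x \<in> streams {0, 1, l} \<and> shd x = 0 \<and> morph_stream (vtm_morph l) x = x)"

text \<open>The fixed point exists and is unique, so the definite description is justified.\<close>

lemma morph_stream_SCons:
  assumes "\<And>a. f a \<noteq> []"
  shows "morph_stream f (a ## x) = f a @- morph_stream f x"
  using assms by (simp add: morph_stream_def flat_Stream)

primcorec queue_stream :: "('a \<Rightarrow> 'a list) \<Rightarrow> 'a list \<Rightarrow> 'a stream" where
  "shd (queue_stream f q) = hd q"
| "stl (queue_stream f q) = queue_stream f (tl q @ f (hd q))"

lemma queue_stream_eq:
  assumes ne: "\<And>a. f a \<noteq> []" and "q \<noteq> []"
  shows "queue_stream f q = q @- morph_stream f (queue_stream f q)"
  using assms(2)
proof (coinduction arbitrary: q)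
  case Eq_stream
  then obtain a r where q: "q = a # r" by (cases q) auto
  have "queue_stream f q = a ## queue_stream f (r @ f a)"
    by (subst queue_stream.code) (simp add: q)
  then have "morph_stream f (queue_stream f q) = f a @- morph_stream f (queue_stream f (r @ f a))"
    by (simp add: morph_stream_SCons ne)
  then show ?case
    by (auto simp: q ne intro!: exI[of _ "r @ f a"])
qed

lemma morph_stream_eq_unique:
  assumes ne: "\<And>a. f a \<noteq> []" and "q \<noteq> []"
    and "s = q @- morph_stream f s" "t = q @- morph_stream f t"
  shows "s = t"
  using assms(2-)
proof (coinduction arbitrary: q s t)
  case Eq_stream
  then obtain a r where q: "q = a # r" by (cases q) auto
  have step: "shd u = a \<and> stl u = (r @ f a) @- morph_stream f (stl u)"
    if "u = q @- morph_stream f u" for u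
  proof -
    have a: "shd u = a" by (subst that) (simp add: q)
    have "stl u = r @- morph_stream f u" by (subst that) (simp add: q)
    also have "morph_stream f u = f a @- morph_stream f (stl u)"
      using morph_stream_SCons[of f a "stl u"] ne a by (metis stream.collapse)
    finally show ?thesis using a by simp
  qed
  have "r @ f a \<noteq> []" using ne by simp
  moreover note s = step[OF Eq_stream(2)] and t = step[OF Eq_stream(3)]
  moreover have "shd s = shd t" using s t by metis
  ultimately show ?case
    by (intro conjI exI[of _ "r @ f a"] exI[of _ "stl s"] exI[of _ "stl t"]) (assumption | rule refl | elim conjE)+
qed

lemma vtm_morph_ne: "vtm_morph l a \<noteq> []"
  by (simp add: vtm_morph_def)

lemma vtm_morph_fixed_iff:
  "shd x = 0 \<and> morph_stream (vtm_morph l) x = x \<longleftrightarrow>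
     shd x = 0 \<and> stl x = [1, l] @- morph_stream (vtm_morph l) (stl x)"
proof -
  have "morph_stream (vtm_morph l) (0 ## stl x) =
      0 ## [1, l] @- morph_stream (vtm_morph l) (stl x)"
    by (simp only: morph_stream_SCons[OF vtm_morph_ne])
      (simp add: vtm_morph_def[of l 0])
  then show ?thesis by (metis stream.collapse stream.inject)
qed

lemma queue_stream_streams:
  assumes "\<And>a. set (f a) \<subseteq> A" "q \<noteq> []" "set q \<subseteq> A" "\<And>a. f a \<noteq> []"
  shows "queue_stream f q \<in> streams A"
  using assms(2,3)
proof (coinduction arbitrary: q rule: streams.coinduct)
  case streams
  then obtain a r where q: "q = a # r" by (cases q) auto
  have "queue_stream f q = a ## queue_stream f (r @ f a)"
    by (subst queue_stream.code) (simp add: q)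
  moreover have "r @ f a \<noteq> []" "set (r @ f a) \<subseteq> A" "a \<in> A"
    using assms(1,4) streams q by auto
  ultimately show ?case by blast
qed

lemma vtm_ex1:
  "\<exists>!x. x \<in> streams {0, 1, l} \<and> shd x = 0 \<and> morph_stream (vtm_morph l) x = x"
proof (rule ex1I)
  let ?t = "queue_stream (vtm_morph l) [1, l]"
  have t_eq: "?t = [1, l] @- morph_stream (vtm_morph l) ?t"
    by (rule queue_stream_eq) (simp_all add: vtm_morph_ne)
  have t_str: "?t \<in> streams {0, 1, l}"
    by (rule queue_stream_streams) (auto simp: vtm_morph_def)
  show "0 ## ?t \<in> streams {0, 1, l} \<and> shd (0 ## ?t) = 0 \<and>
      morph_stream (vtm_morph l) (0 ## ?t) = 0 ## ?t"
  proof (intro conjI)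
    show "0 ## ?t \<in> streams {0, 1, l}" using t_str by (intro streams.intros) simp_all
    have "shd (0 ## ?t) = 0 \<and> stl (0 ## ?t) = [1, l] @- morph_stream (vtm_morph l) (stl (0 ## ?t))"
      unfolding stream.sel using t_eq by (rule conjI[OF refl])
    then have *: "shd (0 ## ?t) = 0 \<and> morph_stream (vtm_morph l) (0 ## ?t) = 0 ## ?t"
      by (rule iffD2[OF vtm_morph_fixed_iff])
    from * show "shd (0 ## ?t) = 0" by (rule conjunct1)
    from * show "morph_stream (vtm_morph l) (0 ## ?t) = 0 ## ?t" by (rule conjunct2)
  qed
  fix x
  assume "x \<in> streams {0, 1, l} \<and> shd x = 0 \<and> morph_stream (vtm_morph l) x = x"
  then have *: "shd x = 0 \<and> stl x = [1, l] @- morph_stream (vtm_morph l) (stl x)"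
    by (intro iffD1[OF vtm_morph_fixed_iff]) (elim conjE, rule conjI)
  have "stl x = ?t"
    by (rule morph_stream_eq_unique[OF vtm_morph_ne _ conjunct2[OF *] t_eq]) simp
  with conjunct1[OF *] show "x = 0 ## ?t" by (metis stream.collapse)
qed

lemma vtm_fixed_point:
  "vtm l \<in> streams {0, 1, l}" "shd (vtm l) = 0" "morph_stream (vtm_morph l) (vtm l) = vtm l"
  using theI'[OF vtm_ex1[of l]] unfolding vtm_def by auto

end

theory Submission
  imports Defs
begin

text \<open>
  Each image of a letter has as many \<open>0\<close>s as \<open>l\<close>s, and none of its prefixes has more than one
  surplus \<open>0\<close> or any surplus \<open>l\<close>. So the difference of these two counts lies in \<open>{0, 1}\<close> on
  prefixes and in \<open>{-1, 0, 1}\<close> on factors of \<open>vtm l\<close>. If \<open>u\<close> and \<open>v\<close> are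
  additively equivalent and \<open>d\<^sub>a\<close> is the difference of their counts of \<open>a\<close>, then
  \<open>d\<^sub>0 - d\<^sub>l = (l - 2) d\<^sub>l\<close>, which is at most \<open>2\<close> in absolute value; hence \<open>d\<^sub>l = 0\<close> for \<open>l \<ge> 5\<close>.
\<close>

definition surplus :: "int \<Rightarrow> int list \<Rightarrow> int" where
  "surplus l w = int (count_list w 0) - int (count_list w l)"

lemma surplus_append: "surplus l (u @ v) = surplus l u + surplus l v"
  by (simp add: surplus_def)

lemma surplus_vtm_morph:
  assumes "l \<noteq> 0" "l \<noteq> 1"
  shows "surplus l (vtm_morph l a) = 0"
  using assms by (simp add: surplus_def vtm_morph_def)

text \<open>The images of 0 and 1 open with their only 0 and close with their only \<open>l\<close>;
  the remaining image \<open>[1]\<close> has neither.\<close>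

lemma surplus_take_vtm_morph:
  assumes "l \<noteq> 0" "l \<noteq> 1"
  shows "surplus l (take n (vtm_morph l a)) \<in> {0, 1}"
  using assms by (auto simp: surplus_def vtm_morph_def take_Cons split: nat.splits)

text \<open>Complete image blocks contribute nothing, so only the last, possibly cut, block counts.
  The stream is arbitrary because the induction passes to its tail, which need not be a fixed
  point.\<close>

lemma surplus_stake_morph_stream:
  assumes "l \<noteq> 0" "l \<noteq> 1"
  shows "surplus l (stake n (morph_stream (vtm_morph l) x)) \<in> {0, 1}"
proof (induction n arbitrary: x rule: less_induct)
  case (less n)
  let ?w = "vtm_morph l (shd x)"
  have x: "morph_stream (vtm_morph l) x = ?w @- morph_stream (vtm_morph l) (stl x)"
    using morph_stream_SCons[of "vtm_morph l" "shd x" "stl x"] by (simp add: vtm_morph_ne)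
  show ?case
  proof (cases "n \<le> length ?w")
    case True
    then show ?thesis
      using surplus_take_vtm_morph[OF assms, of n "shd x"] by (simp add: x stake_shift)
  next
    case False
    have "n - length ?w < n"
      using False vtm_morph_ne[of l "shd x"] by simp
    with less.IH[OF this, of "stl x"] False show ?thesis
      by (simp add: x stake_shift surplus_append surplus_vtm_morph[OF assms])
  qed
qed

lemma surplus_factor:
  assumes "l \<noteq> 0" "l \<noteq> 1" "w \<in> factors (vtm l) n"
  shows "\<bar>surplus l w\<bar> \<le> 1"
proof -
  from assms(3) obtain i where w: "w = stake n (sdrop i (vtm l))"
    by (auto simp: factors_def)
  have prefix: "surplus l (stake k (vtm l)) \<in> {0, 1}" for k
    using surplus_stake_morph_stream[OF assms(1,2), of k "vtm l"]
    by (simp add: vtm_fixed_point(3))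
  \<comment> \<open>A factor is the difference of two prefixes, each of surplus 0 or 1.\<close>
  have "surplus l (stake (i + n) (vtm l)) = surplus l (stake i (vtm l)) + surplus l w"
    by (simp add: w flip: surplus_append)
  with prefix[of i] prefix[of "i + n"] show ?thesis by auto
qed

lemma factors_vtm_letters:
  assumes "w \<in> factors (vtm l) n"
  shows "set w \<subseteq> {0, 1, l}"
proof -
  from assms obtain i where w: "w = stake n (sdrop i (vtm l))"
    by (auto simp: factors_def)
  have "set w \<subseteq> sset (stake i (vtm l) @- w @- sdrop n (sdrop i (vtm l)))"
    by auto
  also have "\<dots> = sset (vtm l)"
    by (simp only: w stake_sdrop)
  also have "\<dots> \<subseteq> {0, 1, l}"
    using vtm_fixed_point(1) by (simp only: streams_iff_sset)
  finally show ?thesis .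
qed

lemma length_eq_count_list_letters:
  fixes l :: int
  assumes "l \<noteq> 0" "l \<noteq> 1" "set w \<subseteq> {0, 1, l}"
  shows "length w = count_list w 0 + count_list w 1 + count_list w l"
  using assms(3) by (induction w) (use assms(1,2) in auto)

text \<open>Integers outside the alphabet have count 0 in both words.\<close>

lemma abelian_equiv_letters_iff:
  assumes "set u \<subseteq> A" "set v \<subseteq> A"
  shows "abelian_equiv u v \<longleftrightarrow> (\<forall>a\<in>A. count_list u a = count_list v a)"
  using assms unfolding abelian_equiv_def by (metis count_list_0_iff subsetD)

lemma additive_equiv_iff_abelian_equiv:
  assumes l: "l \<ge> 5" and u: "u \<in> factors (vtm l) n" and v: "v \<in> factors (vtm l) n"
  shows "additive_equiv l u v \<longleftrightarrow> abelian_equiv u v"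
proof -
  have l01: "l \<noteq> 0" "l \<noteq> 1" using l by auto
  note letters = factors_vtm_letters[OF u] factors_vtm_letters[OF v]
  note lengths = letters[THEN length_eq_count_list_letters[OF l01]]
  note abelian = abelian_equiv_letters_iff[OF letters]
  show ?thesis
  proof
    assume "abelian_equiv u v"
    then show "additive_equiv l u v"
      using lengths by (simp add: abelian additive_equiv_def)
  next
    assume add: "additive_equiv l u v"
    define d where "d a = int (count_list u a) - int (count_list v a)" for a
    have "d 0 + d 1 + d l = 0"
      using add lengths by (simp add: additive_equiv_def d_def)
    moreover have "d 1 + l * d l = 0"
      using add by (simp add: additive_equiv_def d_def algebra_simps)
    \<comment> \<open>Eliminating \<open>d 1\<close> gives
      \<open>d 0 = (l - 1) * d l\<close>.\<close>
    ultimately have "(l - 2) * d l = d 0 - d l"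
      by (simp add: algebra_simps)
    also have "d 0 - d l = surplus l u - surplus l v"
      by (simp add: d_def surplus_def)
    finally have "\<bar>(l - 2) * d l\<bar> \<le> 2"
      using surplus_factor[OF l01 u] surplus_factor[OF l01 v] by linarith
    have "d l = 0"
    proof (rule ccontr)
      assume "d l \<noteq> 0"
      \<comment> \<open>Here \<open>l \<ge> 5\<close> enters: \<open>l - 2\<close> must exceed the
        bound 2.\<close>
      then have "3 * 1 \<le> (l - 2) * \<bar>d l\<bar>"
        using l by (intro mult_mono) auto
      with \<open>\<bar>(l - 2) * d l\<bar> \<le> 2\<close> l show False by (simp add: abs_mult)
    qed
    with \<open>d 1 + l * d l = 0\<close> \<open>d 0 + d 1 + d l = 0\<close>
    have "d 0 = 0" "d 1 = 0" "d l = 0" by simp_all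
    then show "abelian_equiv u v" by (simp add: abelian d_def)
  qed
qed

theorem theorem5p1:
  fixes l :: int
  assumes "l \<ge> 2" and "l \<ge> 5"
  shows "\<forall>n::nat. additive_complexity l (vtm l) n = abelian_complexity (vtm l) n"
proof
  fix n
  let ?F = "factors (vtm l) n"
  \<comment> \<open>The relations themselves agree on factors, so the quotients are the same
    set.\<close>
  have "{(u, v) \<in> ?F \<times> ?F. additive_equiv l u v} = {(u, v) \<in> ?F \<times> ?F. abelian_equiv u v}"
    using additive_equiv_iff_abelian_equiv[OF assms(2)] by blast
  then show "additive_complexity l (vtm l) n = abelian_complexity (vtm l) n"
    by (simp add: additive_complexity_def abelian_complexity_def)
qed

end
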